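(* Let $m\ge1$ and $\kappa_m=\sqrt{\ln(4m)/\pi}$. The average number of nodes of the minimal dag of an $m$-labeled unranked tree of size $n$, taken uniformly at random, satisfies $$\bar N^{\mathcal T}_{m,n}=\kappa_m\frac{n}{\sqrt{\ln n}}\left(1+O\!\left(\frac1{\ln n}\right)\right)\quad(n\to\infty).$$
   Context: An $m$-labeled unranked tree is a non-empty finite rooted tree with node labels in $\{1,\dots,m\}$ and linearly ordered children (any finite number); its size is its number of edges. The number of nodes of its minimal dag is the number of distinct subtrees (subtree = a node with all its descendants, compared as ordered labeled trees). $\bar N^{\mathcal T}_{m,n}$ is the average of this quantity over all $m$-labeled unranked trees of size $n$. *)

theory Defs
  imports Complex_Main "HOL-Library.Landau_Symbols"
begin

datatype utree = Node nat "utree list"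

primrec labelled :: "nat \<Rightarrow> utree \<Rightarrow> bool" where
  "labelled m (Node a ts) = (1 \<le> a \<and> a \<le> m \<and> list_all (labelled m) ts)"

text \<open>Size = number of edges.\<close>
primrec tsize :: "utree \<Rightarrow> nat" where
  "tsize (Node a ts) = length ts + sum_list (map tsize ts)"

primrec subtrees :: "utree \<Rightarrow> utree set" where
  "subtrees (Node a ts) = insert (Node a ts) (\<Union> (set (map subtrees ts)))"

definition trees :: "nat \<Rightarrow> nat \<Rightarrow> utree set" where
  "trees m n = {t. labelled m t \<and> tsize t = n}"

text \<open>Number of nodes of the minimal dag = number of distinct subtrees.\<close>
definition dag_nodes :: "utree \<Rightarrow> nat" where
  "dag_nodes t = card (subtrees t)"

definition avg_dag :: "nat \<Rightarrow> nat \<Rightarrow> real" where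
  "avg_dag m n = (\<Sum>t\<in>trees m n. real (dag_nodes t)) / real (card (trees m n))"

definition kappa :: "nat \<Rightarrow> real" where
  "kappa m = sqrt (ln (4 * real m) / pi)"

end

theory Submission
  imports Defs "HOL-Analysis.Gamma_Function" "HOL-Real_Asymp.Real_Asymp"
    "HOL-Computational_Algebra.Formal_Power_Series"
begin

text \<open>
  There are only \<open>O(n * cb K / K)\<close> trees of size below the threshold \<open>K = \<lceil>ln n / ln (4 m)\<rceil>\<close>, while
  the subtrees of size at least \<open>K\<close> of a random tree are mostly pairwise distinct, so that it
  suffices to count nodes. For a fixed tree \<open>s\<close> of size \<open>k\<close>,
  write \<open>R = (1 - 4 m X) powr (- 1/2)\<close>, whose coefficients are \<open>(4 m) ^ n * cb n\<close>. Over all trees, the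
  occurrences of \<open>s\<close> have generating function \<open>X ^ k * (R + 1) / 2\<close>, and the ordered pairs of
  occurrences \<open>X ^ (2 * k + 2) * R'\<close>. The identity
  \<open>cb k - cb (k + 1) = cb k / (2 * (k + 1))\<close> makes the expected number of nodes with a subtree of size
  at least \<open>K\<close> telescope to about \<open>n * cb K\<close>; the error from repeated subtrees is \<open>O(n * cb K / K)\<close> by
  the second moment, and \<open>cb K\<close> is \<open>1 / sqrt (pi * K)\<close> up to a factor \<open>1 + O(1 / K)\<close> by Wallis'
  product.
\<close>

section \<open>Wallis bounds for normalized central binomial coefficients\<close>

text \<open>\<open>cb n\<close> is the central binomial coefficient divided by \<open>4 ^ n\<close>.\<close>

definition cb :: "nat \<Rightarrow> real" where
  "cb n = (\<Prod>k=1..n. 1 - 1 / (2 * real k))"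

lemma cb_0 [simp]: "cb 0 = 1"
  by (simp add: cb_def)

lemma cb_Suc: "cb (Suc n) = cb n * (1 - 1 / (2 * real (Suc n)))"
  by (simp add: cb_def)

lemma cb_pos: "cb n > 0"
  by (induction n) (auto simp: cb_Suc divide_simps intro!: mult_pos_pos)

lemma cb_diff: "cb n - cb (Suc n) = cb n / (2 * (real n + 1))"
  by (simp add: cb_Suc field_simps)

lemma decseq_cb: "decseq cb"
proof (rule decseq_SucI)
  fix n show "cb (Suc n) \<le> cb n"
    using cb_diff[of n] cb_pos[of n] by (smt (verit) divide_nonneg_nonneg of_nat_0_le_iff)
qed

text \<open>Serves to bound pair counts: a coefficient \<open>i * cb i\<close> with \<open>i\<close>
  below \<open>n\<close> may be replaced by \<open>n * cb n\<close>.\<close>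

lemma incseq_mult_cb: "incseq (\<lambda>n. real n * cb n)"
proof (rule incseq_SucI)
  fix n
  have "real (Suc n) * cb (Suc n) = (real n + 1/2) * cb n"
    by (simp add: cb_Suc field_simps)
  also have "\<dots> \<ge> real n * cb n" using cb_pos[of n] by (intro mult_right_mono) auto
  finally show "real n * cb n \<le> real (Suc n) * cb (Suc n)" .
qed

text \<open>The sequence is the reciprocal of the partial products in Wallis' formula for
  \<open>pi / 2\<close>.\<close>

lemma cb_squared_tendsto: "(\<lambda>n. cb n ^ 2 * (2 * real n + 1)) \<longlonglongrightarrow> 2 / pi"
proof -
  have eq: "cb n ^ 2 * (2 * real n + 1)
        = inverse (\<Prod>k=1..n. (4 * real k ^ 2) / (4 * real k ^ 2 - 1))" for n
  proof (induction n)
    case (Suc n)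
    have ne: "4 * (real n + 1)^2 - 1 = (2 * real n + 1) * (2 * real n + 3)"
      by (simp add: power2_eq_square algebra_simps)
    have "cb (Suc n) ^ 2 * (2 * real (Suc n) + 1)
        = (cb n ^ 2 * (2 * real n + 1)) * ((2 * real n + 1) * (2 * real n + 3) / (4 * (real n + 1)^2))"
      by (simp add: cb_Suc divide_simps power2_eq_square) (simp add: algebra_simps)
    also have "\<dots> = inverse (\<Prod>k=1..n. (4 * real k ^ 2) / (4 * real k ^ 2 - 1)) *
        inverse ((4 * real (Suc n) ^ 2) / (4 * real (Suc n) ^ 2 - 1))"
      by (subst Suc, simp only: of_nat_Suc add.commute[of 1] ne inverse_divide)
    finally show ?case by (simp add: field_simps del: of_nat_Suc)
  qed simp
  have "(\<lambda>n. inverse (\<Prod>k=1..n. (4 * real k ^ 2) / (4 * real k ^ 2 - 1))) \<longlonglongrightarrow> inverse (pi / 2)"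
    by (intro tendsto_inverse wallis) auto
  then show ?thesis by (simp add: eq)
qed

text \<open>The sequence \<open>cb n ^ 2 * (2 * n + 1)\<close> decreases to \<open>2 / pi\<close>,
  because \<open>(2 * n + 1) * (2 * n + 3)\<close> is below \<open>(2 * n + 2) ^ 2\<close>.\<close>

lemma cb_ge: "cb n \<ge> 1 / sqrt (pi * (real n + 1/2))"
proof -
  have "decseq (\<lambda>n. cb n ^ 2 * (2 * real n + 1))"
  proof (rule decseq_SucI)
    fix n
    have "cb (Suc n) ^ 2 * (2 * real (Suc n) + 1)
        = (cb n ^ 2 * (2 * real n + 1)) * ((2 * real n + 1) * (2 * real n + 3) / (4 * (real n + 1)^2))"
      by (simp add: cb_Suc divide_simps power2_eq_square) (simp add: algebra_simps)
    also have "\<dots> \<le> (cb n ^ 2 * (2 * real n + 1)) * 1"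
      by (intro mult_left_mono) (auto simp: divide_simps power2_eq_square, auto simp: algebra_simps)
    finally show "cb (Suc n) ^ 2 * (2 * real (Suc n) + 1) \<le> cb n ^ 2 * (2 * real n + 1)" by simp
  qed
  then have "cb n ^ 2 * (2 * real n + 1) \<ge> 2 / pi"
    using cb_squared_tendsto by (rule decseq_ge)
  then have "(1 / sqrt (pi * (real n + 1/2)))^2 \<le> cb n ^ 2"
    by (simp add: power_divide divide_simps mult_ac) (simp add: algebra_simps)?
  then show ?thesis using cb_pos[of n] by (meson less_le power2_le_imp_le)
qed

text \<open>With \<open>2 * n\<close> in place of \<open>2 * n + 1\<close> the sequence increases to
  the same limit.\<close>

lemma cb_le:
  assumes "n > 0"
  shows "cb n \<le> 1 / sqrt (pi * real n)"
proof -
  have "incseq (\<lambda>n. cb n ^ 2 * (2 * real n))"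
  proof (rule incseq_SucI)
    fix n
    have "cb n ^ 2 * (2 * real n) * 1 \<le> cb n ^ 2 * ((2 * real n + 1)^2 / (2 * real n + 2))"
      unfolding mult.assoc by (intro mult_left_mono) (auto simp: divide_simps power2_eq_square, auto simp: algebra_simps)
    also have "\<dots> = cb (Suc n) ^ 2 * (2 * real (Suc n))"
      by (simp add: cb_Suc divide_simps power2_eq_square) (simp add: algebra_simps)
    finally show "cb n ^ 2 * (2 * real n) \<le> cb (Suc n) ^ 2 * (2 * real (Suc n))" by simp
  qed
  moreover have "(\<lambda>n. cb n ^ 2 * (2 * real n)) \<longlonglongrightarrow> 2 / pi"
  proof -
    have "(\<lambda>n. (cb n ^ 2 * (2 * real n + 1)) * (2 * real n / (2 * real n + 1))) \<longlonglongrightarrow> 2 / pi * 1"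
      by (intro tendsto_mult cb_squared_tendsto) real_asymp
    moreover have "(cb n ^ 2 * (2 * real n + 1)) * (2 * real n / (2 * real n + 1)) = cb n ^ 2 * (2 * real n)" for n
      by (simp add: divide_simps)
    ultimately show ?thesis by simp
  qed
  ultimately have "cb n ^ 2 * (2 * real n) \<le> 2 / pi" by (rule incseq_le)
  then have "cb n ^ 2 \<le> (1 / sqrt (pi * real n))^2"
    using assms by (simp add: power_divide field_simps)
  then show ?thesis by (rule power2_le_imp_le) simp
qed

section \<open>The power series \<open>(1 - 4 m X) powr (- 1/2)\<close> and its differential
  equation\<close>

definition cb_fps :: "nat \<Rightarrow> real fps" where
  "cb_fps m = Abs_fps (\<lambda>n. (4 * real m) ^ n * cb n)"

text \<open>Coefficientwise this is the recurrence
  \<open>(n + 1) * cb (n + 1) = (n + 1/2) * cb n\<close>.\<close>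

lemma cb_fps_deriv: "(1 - fps_const (4 * real m) * fps_X) * fps_deriv (cb_fps m) = fps_const (2 * real m) * cb_fps m"
proof (rule fps_ext)
  fix n
  show "fps_nth ((1 - fps_const (4 * real m) * fps_X) * fps_deriv (cb_fps m)) n
      = fps_nth (fps_const (2 * real m) * cb_fps m) n"
  proof (cases n)
    case (Suc k)
    have "(real k + 2) * cb (Suc (Suc k)) = (real k + 3 / 2) * cb (Suc k)"
      by (simp add: cb_Suc[of "Suc k"] field_simps)
    then have "real m * (4 * real m) ^ k * 4 * real m * 4 * ((real k + 2) * cb (Suc (Suc k)))
        = real m * (4 * real m) ^ k * 4 * real m * 4 * ((real k + 3 / 2) * cb (Suc k))"
      by simp
    then show ?thesis
      by (simp add: Suc cb_fps_def left_diff_distrib mult.assoc algebra_simps)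
  qed (simp add: cb_fps_def left_diff_distrib mult.assoc cb_Suc)
qed

text \<open>By the differential equation the left side has derivative 0, so it equals its constant
  term.\<close>

lemma cb_fps_squared: "(1 - fps_const (4 * real m) * fps_X) * cb_fps m ^ 2 = 1"
proof -
  let ?P = "1 - fps_const (4 * real m) * fps_X" and ?R = "cb_fps m"
  have c: "fps_const (4 * real m) = 2 * fps_const (2 * real m)"
    by (simp add: numeral_fps_const)
  have "fps_deriv (?P * ?R ^ 2) = 2 * ?R * (?P * fps_deriv ?R) - fps_const (4 * real m) * ?R ^ 2"
    by (simp add: power2_eq_square algebra_simps)
  also have "\<dots> = 0"
    by (simp only: cb_fps_deriv) (use c in \<open>simp add: power2_eq_square algebra_simps\<close>)
  finally have "?P * ?R ^ 2 = fps_const (fps_nth (?P * ?R ^ 2) 0)"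
    by (simp only: fps_deriv_eq_0_iff)
  then show ?thesis by (simp add: power2_eq_square cb_fps_def)
qed

text \<open>Multiply the differential equation by \<open>cb_fps m ^ 2\<close>, the inverse of
  \<open>1 - 4 m X\<close>.\<close>

lemma cb_fps_cubed: "fps_deriv (cb_fps m) = fps_const (2 * real m) * cb_fps m ^ 3"
proof -
  let ?P = "1 - fps_const (4 * real m) * fps_X" and ?R = "cb_fps m"
  have "fps_deriv ?R = ?R^2 * (?P * fps_deriv ?R)"
    using cb_fps_squared[of m] by (metis mult.assoc mult.commute mult.right_neutral)
  also have "\<dots> = fps_const (2 * real m) * ?R ^ 3"
    by (simp only: cb_fps_deriv) (simp add: power2_eq_square power3_eq_cube mult_ac)
  finally show ?thesis .
qed

subsection \<open>Forests\<close>

primrec children :: "utree \<Rightarrow> utree list" where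
  "children (Node a ts) = ts"

text \<open>The \<open>Suc\<close> counts the edge from each tree to a common parent, so these are
  exactly the lists of children of trees with \<open>n\<close> edges.\<close>

definition forests :: "nat \<Rightarrow> nat \<Rightarrow> utree list set" where
  "forests m n = {ts. list_all (labelled m) ts \<and> (\<Sum>t\<leftarrow>ts. Suc (tsize t)) = n}"

lemma tsize_Node: "tsize (Node a ts) = (\<Sum>t\<leftarrow>ts. Suc (tsize t))"
  by (simp add: sum_list_Suc)

lemma tsize_child: "t \<in> set ts \<Longrightarrow> tsize t < tsize (Node a ts)"
  by (induction ts) auto

lemma trees_eq: "trees m n = (\<lambda>(a, ts). Node a ts) ` ({1..m} \<times> forests m n)"
proof -
  have "t \<in> trees m n \<longleftrightarrow> t \<in> (\<lambda>(a, ts). Node a ts) ` ({1..m} \<times> forests m n)" for t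
    by (cases t) (auto simp: trees_def forests_def tsize_Node simp del: tsize.simps)
  then show ?thesis by blast
qed

lemma forests_0: "forests m 0 = {[]}"
proof -
  have "ts \<in> forests m 0 \<longleftrightarrow> ts = []" for ts
    by (cases ts) (auto simp: forests_def)
  then show ?thesis by auto
qed

lemma forests_Suc:
  "forests m (Suc n) = (\<lambda>(i, t, us). t # us) ` (SIGMA i:{..n}. trees m i \<times> forests m (n - i))"
proof -
  have "ts \<in> forests m (Suc n) \<longleftrightarrow>
        ts \<in> (\<lambda>(i, t, us). t # us) ` (SIGMA i:{..n}. trees m i \<times> forests m (n - i))" for ts
    by (cases ts) (force simp: forests_def trees_def image_iff)+
  then show ?thesis by blast
qed

lemma finite_forests: "finite (forests m n)"
proof (induction n rule: less_induct)
  case (less n)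
  show ?case
  proof (cases n)
    case (Suc k)
    then show ?thesis
      using less by (auto simp: forests_Suc trees_eq intro!: finite_imageI finite_SigmaI)
  qed (simp add: forests_0)
qed

lemma finite_trees: "finite (trees m n)"
  by (simp add: trees_eq finite_forests)

section \<open>Generating functions of statistics on trees and forests\<close>

definition tree_fps :: "nat \<Rightarrow> (utree \<Rightarrow> real) \<Rightarrow> real fps" where
  "tree_fps m p = Abs_fps (\<lambda>n. \<Sum>t\<in>trees m n. p t)"

definition forest_fps :: "nat \<Rightarrow> (utree list \<Rightarrow> real) \<Rightarrow> real fps" where
  "forest_fps m g = Abs_fps (\<lambda>n. \<Sum>ts\<in>forests m n. g ts)"

lemma tree_fps_add: "tree_fps m (\<lambda>t. p t + q t) = tree_fps m p + tree_fps m q"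
  by (rule fps_ext) (simp add: tree_fps_def sum.distrib)

lemma tree_fps_children:
  "tree_fps m (\<lambda>t. g (children t)) = fps_const (real m) * forest_fps m g"
proof (rule fps_ext)
  fix n
  have "inj_on (\<lambda>(a, ts). Node a ts) ({1..m} \<times> forests m n)"
    by (auto simp: inj_on_def)
  then have "(\<Sum>t\<in>trees m n. g (children t)) = (\<Sum>(a, ts)\<in>{1..m} \<times> forests m n. g ts)"
    by (simp add: trees_eq sum.reindex case_prod_unfold)
  also have "\<dots> = (\<Sum>a\<in>{1..m}. \<Sum>ts\<in>forests m n. g ts)"
    by (simp only: sum.cartesian_product)
  finally show "fps_nth (tree_fps m (\<lambda>t. g (children t))) n = fps_nth (fps_const (real m) * forest_fps m g) n"
    by (simp add: tree_fps_def forest_fps_def)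
qed

lemma tree_fps_delta:
  assumes "labelled m s"
  shows "tree_fps m (\<lambda>t. if t = s then 1 else 0) = fps_X ^ tsize s"
proof (rule fps_ext)
  fix n
  have "s \<in> trees m n \<longleftrightarrow> n = tsize s"
    using assms by (auto simp: trees_def)
  then show "fps_nth (tree_fps m (\<lambda>t. if t = s then 1 else 0)) n = fps_nth (fps_X ^ tsize s) n"
    by (simp add: tree_fps_def finite_trees fps_X_power_nth)
qed

text \<open>Splitting off the first tree turns products into Cauchy products; \<open>fps_X\<close>
  marks the edge above that tree. The counting series, the occurrences and the pairs of occurrences
  all get their equations from this rule.\<close>

lemma forest_fps_Cons:
  assumes "g [] = 0" "\<And>t us. g (t # us) = (\<Sum>j\<in>J. p j t * q j us)"
  shows "forest_fps m g = (\<Sum>j\<in>J. fps_X * (tree_fps m (p j) * forest_fps m (q j)))"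
proof (rule fps_ext)
  fix n
  show "fps_nth (forest_fps m g) n = fps_nth (\<Sum>j\<in>J. fps_X * (tree_fps m (p j) * forest_fps m (q j))) n"
  proof (cases n)
    case (Suc k)
    have inj: "inj_on (\<lambda>(i, t, us). t # us) (SIGMA i:{..k}. trees m i \<times> forests m (k - i))"
      by (auto simp: inj_on_def trees_def)
    have "(\<Sum>ts\<in>forests m (Suc k). g ts)
        = (\<Sum>(i, t, us)\<in>(SIGMA i:{..k}. trees m i \<times> forests m (k - i)). g (t # us))"
      unfolding forests_Suc by (subst sum.reindex[OF inj]) (simp add: case_prod_unfold)
    also have "\<dots> = (\<Sum>i\<le>k. \<Sum>t\<in>trees m i. \<Sum>us\<in>forests m (k - i). g (t # us))"
      by (simp add: sum.Sigma finite_trees finite_forests sum.cartesian_product case_prod_unfold)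
    also have "\<dots> = (\<Sum>i\<le>k. \<Sum>j\<in>J. \<Sum>t\<in>trees m i. \<Sum>us\<in>forests m (k - i). p j t * q j us)"
      unfolding assms(2) by (intro sum.cong refl) (simp only: sum.swap[of _ J])
    also have "\<dots> = (\<Sum>j\<in>J. \<Sum>i\<le>k. (\<Sum>t\<in>trees m i. p j t) * (\<Sum>us\<in>forests m (k - i). q j us))"
      by (subst sum.swap) (simp add: sum_product)
    also have "\<dots> = (\<Sum>j\<in>J. fps_nth (tree_fps m (p j) * forest_fps m (q j)) k)"
      by (simp add: tree_fps_def forest_fps_def fps_mult_nth atMost_atLeast0)
    finally show ?thesis
      by (simp add: Suc fps_sum_nth) (simp add: forest_fps_def)
  qed (simp add: forest_fps_def forests_0 assms fps_sum_nth)
qed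

subsection \<open>Occurrences of a subtree\<close>

text \<open>Counts nodes, so equal subtrees at different nodes count separately, unlike in
  \<open>subtrees\<close>.\<close>

primrec occ :: "utree \<Rightarrow> utree \<Rightarrow> nat" where
  "occ s (Node a ts) = (if Node a ts = s then 1 else 0) + sum_list (map (occ s) ts)"

abbreviation focc :: "utree \<Rightarrow> utree list \<Rightarrow> nat" where
  "focc s ts \<equiv> sum_list (map (occ s) ts)"

lemma occ_eq: "occ s t = (if t = s then 1 else 0) + focc s (children t)"
  by (cases t) simp

lemma occ_eq_0_iff: "occ s t = 0 \<longleftrightarrow> s \<notin> subtrees t"
  by (induction t) (auto simp: sum_list_eq_0_iff)

lemma tsize_subtree: "s \<in> subtrees t \<Longrightarrow> tsize s \<le> tsize t"
proof (induction t)
  case (Node a ts)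
  then show ?case
    using tsize_child[of _ ts a] by (fastforce simp del: tsize.simps)
qed

lemma finite_subtrees: "finite (subtrees t)"
  by (induction t) auto

text \<open>Every tree below the root of \<open>s\<close> has fewer edges than
  \<open>s\<close>.\<close>

lemma focc_children_self: "focc s (children s) = 0"
proof (cases s)
  case (Node a ts)
  have "occ s t = 0" if "t \<in> set ts" for t
    using tsize_child[OF that, of a] tsize_subtree[of s t] Node by (auto simp: occ_eq_0_iff)
  then show ?thesis by (simp add: Node sum_list_eq_0_iff)
qed

text \<open>Each node is an occurrence of exactly one tree, and there is one more node than
  edges.\<close>

lemma sum_occ:
  "finite S \<Longrightarrow> subtrees t \<subseteq> S \<Longrightarrow> (\<Sum>s\<in>S. occ s t) = Suc (tsize t)"
proof (induction t)
  case (Node a ts)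
  have "(\<Sum>s\<in>S. focc s ts) = (\<Sum>t\<leftarrow>ts. \<Sum>s\<in>S. occ s t)"
    by (induction ts) (auto simp: sum.distrib)
  also have "\<dots> = (\<Sum>t\<leftarrow>ts. Suc (tsize t))"
    using Node by (intro arg_cong[of _ _ sum_list] map_cong refl Node.IH) auto
  finally show ?case using Node.prems by (simp add: sum.distrib tsize_Node del: tsize.simps)
qed

subsection \<open>Closed forms of the generating functions\<close>

text \<open>The Catalan-type equation: a nonempty forest is a first tree, a root label with a forest
  below it, followed by another forest.\<close>

lemma forest_fps_one_eq:
  "forest_fps m (\<lambda>_. 1) = 1 + fps_X * fps_const (real m) * forest_fps m (\<lambda>_. 1) ^ 2"
proof -
  let ?g = "\<lambda>ts :: utree list. if ts = [] then 0 else 1 :: real"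
  have "forest_fps m (\<lambda>_. 1) = 1 + forest_fps m ?g"
  proof (rule fps_ext)
    fix n
    show "fps_nth (forest_fps m (\<lambda>_. 1)) n = fps_nth (1 + forest_fps m ?g) n"
    proof (cases n)
      case (Suc k)
      have "ts \<noteq> []" if "ts \<in> forests m n" for ts
        using that Suc by (auto simp: forests_def)
      then have "(\<Sum>ts\<in>forests m n. 1) = (\<Sum>ts\<in>forests m n. ?g ts)"
        by (intro sum.cong) auto
      then show ?thesis by (simp add: Suc forest_fps_def)
    qed (simp add: forest_fps_def forests_0)
  qed
  also have "forest_fps m ?g = (\<Sum>j\<in>{()}. fps_X * (tree_fps m (\<lambda>_. 1) * forest_fps m (\<lambda>_. 1)))"
    by (rule forest_fps_Cons) auto
  also have "tree_fps m (\<lambda>_. 1) = fps_const (real m) * forest_fps m (\<lambda>_. 1)"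
    by (rule tree_fps_children)
  finally show ?thesis by (simp add: power2_eq_square mult_ac)
qed

text \<open>Completing the square in the quadratic equation shows that the first factor squares to
  \<open>1 - 4 m X\<close>, so the product squares to 1; constant terms fix the sign. The first
  factor is the one that recurs in all later linear equations.\<close>

lemma forest_fps_one_mult_cb_fps:
  "(1 - fps_X * fps_const (2 * real m) * forest_fps m (\<lambda>_. 1)) * cb_fps m = 1"
proof -
  let ?F = "forest_fps m (\<lambda>_. 1)" and ?R = "cb_fps m" and ?c = "fps_const (real m)"
  define S where "S = 1 - fps_X * fps_const (2 * real m) * ?F"
  have c: "fps_const (2 * real m) = 2 * ?c" "fps_const (4 * real m) = 4 * ?c"
    by (simp_all add: numeral_fps_const)
  have "S ^ 2 = 1 - 4 * ?c * fps_X * (?F - fps_X * ?c * ?F ^ 2)"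
    by (simp only: S_def c) (simp add: power2_eq_square algebra_simps)
  also have "?F - fps_X * ?c * ?F ^ 2 = 1"
    using forest_fps_one_eq[of m] by (simp add: algebra_simps)
  finally have "(S * ?R) ^ 2 = 1"
    using cb_fps_squared[of m] by (simp only: power_mult_distrib mult_1_right c)
  then have "S * ?R = 1 \<or> S * ?R = - 1" by (simp only: power2_eq_1_iff)
  moreover have "fps_nth (S * ?R) 0 \<noteq> fps_nth (- 1) 0"
    by (simp add: S_def cb_fps_def)
  ultimately have "S * ?R = 1" by metis
  then show ?thesis by (simp only: S_def)
qed

text \<open>Solving for the forest series gives \<open>2 m X F = 1 - (1 - 4 m X) * R\<close>; its
  coefficient at \<open>Suc n\<close> is a difference of consecutive \<open>cb\<close>
  values.\<close>

lemma card_forests: "real (card (forests m n)) = (4 * real m) ^ n * cb n / (real n + 1)"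
\<comment> \<open>Separated because the general case ends by cancelling
  \<open>2 * m\<close>.\<close>
proof (cases "m = 0")
  case True
  have "forests 0 (Suc n) = {}" for n by (simp add: forests_Suc trees_eq)
  with True show ?thesis by (cases n) (auto simp: forests_0)
next
  case False
  let ?F = "forest_fps m (\<lambda>_. 1)" and ?R = "cb_fps m"
  have "fps_X * fps_const (2 * real m) * ?F =
      1 - (1 - fps_X * fps_const (2 * real m) * ?F) * ((1 - fps_const (4 * real m) * fps_X) * ?R ^ 2)"
    by (simp only: cb_fps_squared) simp
  also have "\<dots> = 1 - (1 - fps_const (4 * real m) * fps_X) * ?R *
      ((1 - fps_X * fps_const (2 * real m) * ?F) * ?R)"
    by (simp add: power2_eq_square mult_ac)
  also have "\<dots> = 1 - (1 - fps_const (4 * real m) * fps_X) * ?R"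
    by (simp only: forest_fps_one_mult_cb_fps) simp
  finally have "fps_X * (fps_const (2 * real m) * ?F) = 1 - (?R - fps_X * (fps_const (4 * real m) * ?R))"
    by (simp add: algebra_simps)
  then have "fps_nth (fps_X * (fps_const (2 * real m) * ?F)) (Suc n) =
      fps_nth (1 - (?R - fps_X * (fps_const (4 * real m) * ?R))) (Suc n)"
    by (rule arg_cong)
  then have "2 * real m * real (card (forests m n)) = (4 * real m) ^ Suc n * (cb n - cb (Suc n))"
    by (simp add: forest_fps_def cb_fps_def algebra_simps)
  also have "\<dots> = 2 * real m * ((4 * real m) ^ n * cb n / (real n + 1))"
    unfolding cb_diff by (simp add: field_simps)
  finally show ?thesis using False by (subst (asm) mult_left_cancel) auto
qed

lemma card_trees: "real (card (trees m n)) = real m * (4 * real m) ^ n * cb n / (real n + 1)"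
proof -
  have "real (card (trees m n)) = fps_nth (tree_fps m (\<lambda>_. 1)) n"
    by (simp add: tree_fps_def)
  also have "tree_fps m (\<lambda>_. 1) = fps_const (real m) * forest_fps m (\<lambda>_. 1)"
    by (rule tree_fps_children)
  finally show ?thesis by (simp add: forest_fps_def card_forests)
qed

text \<open>An occurrence is the root or lies in the forest of children, and there in the first tree
  or in the rest. This gives a linear equation for the forest series, solved by multiplying with
  \<open>cb_fps m\<close>.\<close>

lemma tree_fps_occ:
  assumes "labelled m s"
  shows "2 * tree_fps m (\<lambda>t. real (occ s t)) = fps_X ^ tsize s * (cb_fps m + 1)"
    and "fps_const (2 * real m) * forest_fps m (\<lambda>ts. real (focc s ts)) = fps_X ^ tsize s * (cb_fps m - 1)"
proof -
  let ?A = "forest_fps m (\<lambda>ts. real (focc s ts))" and ?c = "fps_const (real m)"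
  let ?F = "forest_fps m (\<lambda>_. 1)" and ?R = "cb_fps m" and ?X = "fps_X :: real fps"
  have c: "fps_const (2 * real m) = 2 * ?c" "fps_const (4 * real m) = 4 * ?c"
    by (simp_all add: numeral_fps_const)
  have T: "tree_fps m (\<lambda>t. real (occ s t)) = ?X ^ tsize s + ?c * ?A"
  proof -
    have "real (occ s t) = (if t = s then 1 else 0) + real (focc s (children t))" for t
      by (simp add: occ_eq)
    then show ?thesis
      by (simp only: tree_fps_add tree_fps_delta[OF assms]
          tree_fps_children[where g = "\<lambda>ts. real (focc s ts)"])
  qed
  have T1: "tree_fps m (\<lambda>_. 1) = ?c * ?F"
    by (rule tree_fps_children)
  have "?A = (\<Sum>b\<in>{True, False}. ?X * (tree_fps m (if b then (\<lambda>t. real (occ s t)) else (\<lambda>_. 1)) *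
      forest_fps m (if b then (\<lambda>_. 1) else (\<lambda>ts. real (focc s ts)))))"
    by (rule forest_fps_Cons) auto
  then have "?A = ?X * (?X ^ tsize s + ?c * ?A) * ?F + ?X * ?c * ?F * ?A"
    by (simp add: T T1 mult_ac)
  then have A: "?A * (1 - ?X * (2 * ?c) * ?F) = ?X * ?X ^ tsize s * ?F"
    by (simp add: algebra_simps)
  have SR: "(1 - ?X * (2 * ?c) * ?F) * ?R = 1"
    using forest_fps_one_mult_cb_fps[of m] by (simp only: c)
  have "2 * ?c * ?A = 2 * ?c * ?A * ((1 - ?X * (2 * ?c) * ?F) * ?R)"
    by (simp only: SR mult_1_right)
  also have "\<dots> = 2 * ?c * (?A * (1 - ?X * (2 * ?c) * ?F)) * ?R"
    by (simp only: mult.assoc)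
  also have "\<dots> = ?X ^ tsize s * (?R - (1 - ?X * (2 * ?c) * ?F) * ?R)"
    unfolding A by (simp add: algebra_simps)
  also have "\<dots> = ?X ^ tsize s * (?R - 1)" by (simp only: SR)
  finally have A': "2 * ?c * ?A = ?X ^ tsize s * (?R - 1)" .
  then show "fps_const (2 * real m) * ?A = ?X ^ tsize s * (?R - 1)" by (simp only: c)
  show "2 * tree_fps m (\<lambda>t. real (occ s t)) = ?X ^ tsize s * (?R + 1)"
    using A' unfolding T by (simp add: algebra_simps)
qed

text \<open>When \<open>t = s\<close> there is no occurrence of \<open>s\<close> below the root, so pairs of occurrences never
  involve the root and the generating function satisfies a linear equation.\<close>

lemma tree_fps_occ_pairs:
  assumes "labelled m s"
  shows "tree_fps m (\<lambda>t. real (occ s t) * (real (occ s t) - 1)) =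
           fps_X ^ (2 * tsize s + 2) * fps_deriv (cb_fps m)"
proof -
  let ?A = "forest_fps m (\<lambda>ts. real (focc s ts))" and ?c = "fps_const (real m)"
  let ?q = "\<lambda>ts. real (focc s ts) * (real (focc s ts) - 1)"
  let ?F = "forest_fps m (\<lambda>_. 1)" and ?R = "cb_fps m" and ?X = "fps_X :: real fps"
  let ?Q = "forest_fps m ?q" and ?k = "tsize s"
  let ?T = "tree_fps m (\<lambda>t. real (occ s t))"
  have c: "fps_const (2 * real m) = 2 * ?c" "fps_const (4 * real m) = 4 * ?c"
    by (simp_all add: numeral_fps_const)
  have "real (occ s t) * (real (occ s t) - 1) = ?q (children t)" for t
    by (auto simp: occ_eq focc_children_self)
  then have TQ: "tree_fps m (\<lambda>t. real (occ s t) * (real (occ s t) - 1)) = ?c * ?Q"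
    by (simp only: tree_fps_children[where g = ?q])
  have T1: "tree_fps m (\<lambda>_. 1) = ?c * ?F"
    by (rule tree_fps_children)
  \<comment> \<open>Index 0 puts both occurrences into the first tree, 1 both into the rest; 2 and 3
    are the two orders of a mixed pair.\<close>
  define p where "p j = (if j = 0 then (\<lambda>t. real (occ s t) * (real (occ s t) - 1))
     else if j = 1 then (\<lambda>_. 1) else (\<lambda>t. real (occ s t)))" for j :: nat
  define q where "q j = (if j = 0 then (\<lambda>_. 1) else if j = 1 then ?q else (\<lambda>ts. real (focc s ts)))"
    for j :: nat
  have "?Q = (\<Sum>j\<in>{0, 1, 2, 3}. ?X * (tree_fps m (p j) * forest_fps m (q j)))"
    by (rule forest_fps_Cons) (auto simp: p_def q_def algebra_simps)
  also have "\<dots> = ?X * (?c * ?Q * ?F + ?c * ?F * ?Q + ?T * ?A + ?T * ?A)"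
    by (simp add: p_def q_def TQ T1) (simp add: algebra_simps)
  finally have Q: "?Q * (1 - ?X * (2 * ?c) * ?F) = ?X * ((2 * ?T) * ?A)"
    by (simp add: algebra_simps)
  have SR: "(1 - ?X * (2 * ?c) * ?F) * ?R = 1"
    using forest_fps_one_mult_cb_fps[of m] by (simp only: c)
  have "2 * ?c * ?Q = 2 * ?c * ?Q * ((1 - ?X * (2 * ?c) * ?F) * ?R)"
    by (simp only: SR mult_1_right)
  also have "\<dots> = 2 * ?c * (?Q * (1 - ?X * (2 * ?c) * ?F)) * ?R"
    by (simp only: mult.assoc)
  also have "\<dots> = ?X * (2 * ?T) * (2 * ?c * ?A) * ?R"
    unfolding Q by (simp add: mult_ac)
  also have "\<dots> = ?X ^ (2 * ?k + 1) * ((?R ^ 2 - 1) * ?R)"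
    unfolding tree_fps_occ(1)[OF assms] tree_fps_occ(2)[OF assms, unfolded c]
    by (simp add: power2_eq_square power_add power_mult mult.commute[of 2] algebra_simps)
  \<comment> \<open>This yields the second extra factor \<open>fps_X\<close>; the first is the edge
    above the first tree.\<close>
  also have "?R ^ 2 - 1 = 4 * ?c * ?X * ?R ^ 2"
    using cb_fps_squared[of m, unfolded c] by (simp add: algebra_simps)
  also have "?X ^ (2 * ?k + 1) * ((4 * ?c * ?X * ?R ^ 2) * ?R) = 2 * (?X ^ (2 * ?k + 2) * fps_deriv ?R)"
    unfolding cb_fps_cubed c by (simp add: power2_eq_square power3_eq_cube mult_ac)
  finally have "2 * (?c * ?Q) = 2 * (?X ^ (2 * ?k + 2) * fps_deriv ?R)" by (simp only: mult.assoc)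
  then show ?thesis unfolding TQ by simp
qed

text \<open>Passing from \<open>cb (n - tsize s)\<close> to the smaller \<open>cb n\<close> matches
  the factor in \<open>card_trees\<close>, which makes the later sum over sizes telescope.\<close>

lemma sum_occ_ge:
  assumes "labelled m s" "tsize s \<le> n"
  shows "(\<Sum>t\<in>trees m n. real (occ s t)) \<ge> (4 * real m) ^ (n - tsize s) * cb n / 2"
proof -
  have "2 * (\<Sum>t\<in>trees m n. real (occ s t)) = fps_nth (2 * tree_fps m (\<lambda>t. real (occ s t))) n"
    by (simp add: tree_fps_def numeral_fps_const)
  also have "\<dots> \<ge> (4 * real m) ^ (n - tsize s) * cb (n - tsize s)"
    using assms(2) unfolding tree_fps_occ[OF assms(1)] by (simp add: fps_X_power_mult_nth cb_fps_def)
  finally have "2 * (\<Sum>t\<in>trees m n. real (occ s t)) \<ge> (4 * real m) ^ (n - tsize s) * cb (n - tsize s)" .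
  moreover have "(4 * real m) ^ (n - tsize s) * cb (n - tsize s) \<ge> (4 * real m) ^ (n - tsize s) * cb n"
    using decseqD[OF decseq_cb, of "n - tsize s" n] by (intro mult_left_mono) auto
  ultimately show ?thesis by linarith
qed

lemma sum_occ_pairs_le:
  assumes "labelled m s"
  shows "(\<Sum>t\<in>trees m n. real (occ s t) * (real (occ s t) - 1)) * (4 * real m) ^ (2 * tsize s + 1)
           \<le> (4 * real m) ^ n * (real n * cb n)"
proof -
  have *: "(\<Sum>t\<in>trees m n. real (occ s t) * (real (occ s t) - 1)) =
      fps_nth (fps_X ^ (2 * tsize s + 2) * fps_deriv (cb_fps m)) n"
    unfolding tree_fps_occ_pairs[OF assms, symmetric] by (simp add: tree_fps_def)
  show ?thesis
  proof (cases "n < 2 * tsize s + 2")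
    case True
    then show ?thesis unfolding * fps_X_power_mult_nth using cb_pos[of n] by simp
  next
    case False
    define i where "i = n - (2 * tsize s + 1)"
    have i: "Suc (n - (2 * tsize s + 2)) = i" "n = i + (2 * tsize s + 1)"
      using False by (auto simp: i_def)
    have "(\<Sum>t\<in>trees m n. real (occ s t) * (real (occ s t) - 1)) = (4 * real m) ^ i * (real i * cb i)"
      unfolding * fps_X_power_mult_nth using False i(1)
      by (simp add: cb_fps_def del: of_nat_Suc power_Suc)
    then have "(\<Sum>t\<in>trees m n. real (occ s t) * (real (occ s t) - 1)) * (4 * real m) ^ (2 * tsize s + 1)
        = (4 * real m) ^ n * (real i * cb i)"
      unfolding i(2) power_add by (simp only: mult_ac)
    also have "\<dots> \<le> (4 * real m) ^ n * (real n * cb n)"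
      using incseqD[OF incseq_mult_cb, of i n] i by (intro mult_left_mono) auto
    finally show ?thesis .
  qed
qed

subsection \<open>Bounds for the average\<close>

lemma sum_UN_trees:
  "finite I \<Longrightarrow> (\<Sum>s\<in>(\<Union>k\<in>I. trees m k). f s) = (\<Sum>k\<in>I. \<Sum>s\<in>trees m k. f s)"
  by (rule sum.UNION_disjoint) (auto simp: finite_trees, auto simp: trees_def)

lemma card_trees_pos: "m \<ge> 1 \<Longrightarrow> card (trees m n) > 0"
  using cb_pos[of n] card_trees[of m n] by (cases "card (trees m n) = 0") auto

text \<open>The bound telescopes in \<open>k\<close>. Its total over all \<open>k\<close> is nearly the exact number of nodes, so it
  also yields an upper bound for the number of large subtrees.\<close>

lemma sum_sum_occ_ge:
  assumes "k \<le> n"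
  shows "(\<Sum>s\<in>trees m k. \<Sum>t\<in>trees m n. real (occ s t))
           \<ge> real (card (trees m n)) * (real n + 1) * (cb k - cb (Suc k))"
proof -
  have "real (card (trees m n)) * (real n + 1) * (cb k - cb (Suc k)) =
      (real m * (4 * real m) ^ k * cb k / (real k + 1)) * ((4 * real m) ^ (n - k) * cb n / 2)"
  proof -
    have "(4 * real m) ^ n = (4 * real m) ^ k * (4 * real m) ^ (n - k)"
      using power_add[of "4 * real m" k "n - k"] assms by simp
    then show ?thesis unfolding card_trees cb_diff by (simp add: divide_simps)
  qed
  also have "\<dots> = (\<Sum>s\<in>trees m k. (4 * real m) ^ (n - k) * cb n / 2)"
    by (simp only: sum_constant card_trees)
  also have "\<dots> \<le> (\<Sum>s\<in>trees m k. \<Sum>t\<in>trees m n. real (occ s t))"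
  proof (rule sum_mono)
    fix s assume "s \<in> trees m k"
    then show "(4 * real m) ^ (n - k) * cb n / 2 \<le> (\<Sum>t\<in>trees m n. real (occ s t))"
      using sum_occ_ge[of m s n] assms by (auto simp: trees_def)
  qed
  finally show ?thesis .
qed

text \<open>Small distinct subtrees number at most all small trees. Large ones number at most the
  nodes carrying them, which are all \<open>n + 1\<close> nodes minus the small occurrences.\<close>

lemma avg_dag_le:
  assumes "m \<ge> 1" "K \<le> n"
  shows "avg_dag m n \<le> (\<Sum>k<K. real (card (trees m k))) + (real n + 1) * cb K"
proof -
  let ?T = "trees m n" and ?N = "real (card (trees m n))"
  define L where "L = (\<Union>k<K. trees m k)"
  have fin: "finite L" by (simp add: L_def finite_trees)
  have L: "real (card L) = (\<Sum>k<K. real (card (trees m k)))"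
    using sum_UN_trees[of "{..<K}" "\<lambda>_. 1 :: real" m] by (simp add: L_def)
  have dag: "real (dag_nodes t) \<le> real (card L) + (real n + 1) - (\<Sum>s\<in>L. real (occ s t))"
    if t: "t \<in> ?T" for t
  proof -
    let ?S = "subtrees t \<union> L"
    have "dag_nodes t \<le> card (L \<union> (?S - L))"
      unfolding dag_nodes_def using fin finite_subtrees by (intro card_mono) auto
    also have "\<dots> = card L + card (?S - L)"
      using fin finite_subtrees by (intro card_Un_disjoint) auto
    also have "card (?S - L) = (\<Sum>s\<in>?S - L. 1)" by simp
    also have "\<dots> \<le> (\<Sum>s\<in>?S - L. occ s t)"
      by (rule sum_mono) (auto simp: Suc_le_eq occ_eq_0_iff simp flip: neq0_conv)
    finally have "real (dag_nodes t) \<le> real (card L) + real (\<Sum>s\<in>?S - L. occ s t)" by linarith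
    moreover have "(\<Sum>s\<in>?S - L. occ s t) + (\<Sum>s\<in>L. occ s t) = (\<Sum>s\<in>?S. occ s t)"
      using fin finite_subtrees by (intro sum.subset_diff[symmetric]) auto
    moreover have "(\<Sum>s\<in>?S. occ s t) = Suc n"
      using fin finite_subtrees t by (subst sum_occ) (auto simp: trees_def)
    ultimately show ?thesis by (simp flip: of_nat_sum)
  qed
  have "?N * ((real n + 1) * (1 - cb K)) = (\<Sum>k<K. ?N * (real n + 1) * (cb k - cb (Suc k)))"
    unfolding sum_distrib_left[symmetric] sum_lessThan_telescope' by simp
  also have "\<dots> \<le> (\<Sum>k<K. \<Sum>s\<in>trees m k. \<Sum>t\<in>?T. real (occ s t))"
    using assms by (intro sum_mono sum_sum_occ_ge) auto
  also have "\<dots> = (\<Sum>t\<in>?T. \<Sum>s\<in>L. real (occ s t))"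
    unfolding L_def by (subst sum.swap) (simp add: sum_UN_trees)
  finally have occ: "(\<Sum>t\<in>?T. \<Sum>s\<in>L. real (occ s t)) \<ge> ?N * ((real n + 1) * (1 - cb K))" .
  have "(\<Sum>t\<in>?T. real (dag_nodes t)) \<le> (\<Sum>t\<in>?T. real (card L) + (real n + 1) - (\<Sum>s\<in>L. real (occ s t)))"
    by (intro sum_mono dag)
  also have "\<dots> \<le> ?N * (real (card L) + (real n + 1)) - ?N * ((real n + 1) * (1 - cb K))"
    using occ by (simp add: sum_subtractf)
  also have "\<dots> = (real (card L) + (real n + 1) * cb K) * ?N" by (simp add: algebra_simps)
  finally show ?thesis
    using card_trees_pos[OF assms(1), of n] unfolding avg_dag_def L by (simp add: pos_divide_le_eq)
qed

text \<open>Bonferroni's inequality, applied to the occurrences of each tree with between \<open>K\<close> and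
  \<open>n - 1\<close> edges.\<close>

lemma avg_dag_ge:
  assumes "m \<ge> 1" "K \<le> n"
  shows "avg_dag m n \<ge> (real n + 1) * (cb K - cb n - real n * cb K / (2 * (real K + 1) * (4 * real m) ^ K))"
proof -
  let ?T = "trees m n" and ?N = "real (card (trees m n))" and ?q = "4 * real m"
  define L where "L = (\<Union>k\<in>{K..<n}. trees m k)"
  have fin: "finite L" by (simp add: L_def finite_trees)
  have dag: "real (dag_nodes t) \<ge> (\<Sum>s\<in>L. real (occ s t) - real (occ s t) * (real (occ s t) - 1) / 2)" for t
  proof -
    \<comment> \<open>Amounts to \<open>(x - 1) * (x - 2) \<ge> 0\<close>, which holds at every
      natural number.\<close>
    have le: "real x - real x * (real x - 1) / 2 \<le> 1" for x :: nat
    proof (cases "x \<le> 1")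
      case False
      then have "0 \<le> (real x - 1) * (real x - 2)" by (intro mult_nonneg_nonneg) auto
      then show ?thesis by (simp add: field_simps)
    qed (use le_Suc_eq in auto)
    have "(\<Sum>s\<in>L. real (occ s t) - real (occ s t) * (real (occ s t) - 1) / 2)
        \<le> (\<Sum>s\<in>L. if s \<in> subtrees t then 1 else 0)"
      by (intro sum_mono) (auto simp: le occ_eq_0_iff[symmetric])
    also have "\<dots> = real (card (L \<inter> subtrees t))"
      using fin by (simp add: sum.If_cases Int_def)
    also have "\<dots> \<le> real (dag_nodes t)"
      unfolding dag_nodes_def using finite_subtrees by (simp add: card_mono)
    finally show ?thesis .
  qed
  have pairs: "(\<Sum>s\<in>trees m k. \<Sum>t\<in>?T. real (occ s t) * (real (occ s t) - 1))
      \<le> ?N * (real n + 1) * (real n * cb K / (real K + 1)) * (1 / ?q ^ k - 1 / ?q ^ Suc k)"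
    if "K \<le> k" for k
  proof -
    have "(\<Sum>s\<in>trees m k. \<Sum>t\<in>?T. real (occ s t) * (real (occ s t) - 1))
        \<le> (\<Sum>s\<in>trees m k. ?q ^ n * (real n * cb n) / ?q ^ (2 * k + 1))"
    proof (rule sum_mono)
      fix s assume "s \<in> trees m k"
      then have "(\<Sum>t\<in>?T. real (occ s t) * (real (occ s t) - 1)) * ?q ^ (2 * k + 1) \<le> ?q ^ n * (real n * cb n)"
        using sum_occ_pairs_le[of m s n] by (auto simp: trees_def)
      then show "(\<Sum>t\<in>?T. real (occ s t) * (real (occ s t) - 1)) \<le> ?q ^ n * (real n * cb n) / ?q ^ (2 * k + 1)"
        using assms(1) by (subst pos_le_divide_eq) auto
    qed
    also have "\<dots> = ?N * (real n + 1) * real n * (cb k / (real k + 1)) * (1 / ?q ^ Suc k)"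
      unfolding sum_constant card_trees using assms(1)
      by (simp add: divide_simps mult_2 power_add)
    also have "\<dots> \<le> ?N * (real n + 1) * real n * (cb K / (real K + 1)) * (1 / ?q ^ k - 1 / ?q ^ Suc k)"
    proof (rule mult_mono)
      have "cb k / (real k + 1) \<le> cb K / (real K + 1)"
        using that decseqD[OF decseq_cb that] cb_pos[of k] by (intro frac_le) auto
      then show "?N * (real n + 1) * real n * (cb k / (real k + 1)) \<le>
          ?N * (real n + 1) * real n * (cb K / (real K + 1))"
        by (intro mult_left_mono) auto
      \<comment> \<open>Since \<open>4 * m\<close> is at least 2, the geometric terms are dominated
        by telescoping differences.\<close>
      show "1 / ?q ^ Suc k \<le> 1 / ?q ^ k - 1 / ?q ^ Suc k"
        using assms(1) by (simp add: field_simps)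
    qed (use cb_pos[of K] in auto)
    finally show ?thesis by (simp add: mult.assoc)
  qed
  have "(\<Sum>k\<in>{K..<n}. \<Sum>s\<in>trees m k. \<Sum>t\<in>?T. real (occ s t) * (real (occ s t) - 1))
      \<le> (\<Sum>k\<in>{K..<n}. ?N * (real n + 1) * (real n * cb K / (real K + 1)) * (1 / ?q ^ k - 1 / ?q ^ Suc k))"
    by (intro sum_mono pairs) auto
  also have "\<dots> = ?N * (real n + 1) * (real n * cb K / (real K + 1)) * (1 / ?q ^ K - 1 / ?q ^ n)"
    unfolding sum_distrib_left[symmetric] using sum_Suc_diff'[of K n "\<lambda>k. - (1 / ?q ^ k)"] assms by simp
  also have "\<dots> \<le> ?N * (real n + 1) * (real n * cb K / (real K + 1)) * (1 / ?q ^ K)"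
    using cb_pos[of K] by (intro mult_left_mono) auto
  finally have P: "(\<Sum>k\<in>{K..<n}. \<Sum>s\<in>trees m k. \<Sum>t\<in>?T. real (occ s t) * (real (occ s t) - 1))
      \<le> ?N * (real n + 1) * (real n * cb K / (real K + 1)) * (1 / ?q ^ K)" .
  have "?N * (real n + 1) * (cb K - cb n) = (\<Sum>k\<in>{K..<n}. ?N * (real n + 1) * (cb k - cb (Suc k)))"
    unfolding sum_distrib_left[symmetric] using sum_Suc_diff'[of K n "\<lambda>k. - cb k"] assms by simp
  also have "\<dots> \<le> (\<Sum>k\<in>{K..<n}. \<Sum>s\<in>trees m k. \<Sum>t\<in>?T. real (occ s t))"
    by (intro sum_mono sum_sum_occ_ge) auto
  finally have Q: "?N * (real n + 1) * (cb K - cb n)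
      \<le> (\<Sum>k\<in>{K..<n}. \<Sum>s\<in>trees m k. \<Sum>t\<in>?T. real (occ s t))" .
  have "?N * (real n + 1) * (cb K - cb n) -
      ?N * (real n + 1) * (real n * cb K / (real K + 1)) * (1 / ?q ^ K) / 2
      \<le> (\<Sum>k\<in>{K..<n}. \<Sum>s\<in>trees m k. \<Sum>t\<in>?T. real (occ s t)) -
         (\<Sum>k\<in>{K..<n}. \<Sum>s\<in>trees m k. \<Sum>t\<in>?T. real (occ s t) * (real (occ s t) - 1)) / 2"
    by (intro diff_mono divide_right_mono P Q) simp
  also have "\<dots> = (\<Sum>t\<in>?T. \<Sum>s\<in>L. real (occ s t) - real (occ s t) * (real (occ s t) - 1) / 2)"
    unfolding L_def by (subst sum.swap)
      (simp add: sum_UN_trees sum_subtractf sum_divide_distrib)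
  also have "\<dots> \<le> (\<Sum>t\<in>?T. real (dag_nodes t))"
    by (intro sum_mono dag)
  also have "?N * (real n + 1) * (cb K - cb n) -
      ?N * (real n + 1) * (real n * cb K / (real K + 1)) * (1 / ?q ^ K) / 2 =
      ((real n + 1) * (cb K - cb n - real n * cb K / (2 * (real K + 1) * ?q ^ K))) * ?N"
  proof -
    have "real n * cb K / (2 * (real K + 1) * ?q ^ K) = real n * cb K / (real K + 1) * (1 / ?q ^ K) / 2"
      by (simp add: mult_ac)
    moreover have "?N * a * (x - y) - ?N * a * c * d / 2 = a * (x - y - c * d / 2) * ?N" for a x y c d :: real
      by (simp add: field_simps)
    ultimately show ?thesis by (simp only:)
  qed
  finally show ?thesis
    using card_trees_pos[OF assms(1), of n] unfolding avg_dag_def by (simp add: pos_le_divide_eq)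
qed

section \<open>Choice of the threshold and the explicit error bound\<close>

text \<open>From size 1 on the counts grow by a factor \<open>r\<close> of at least
  \<open>3/2\<close>, so \<open>2 + 1 \<le> 2 * r\<close> carries the induction.\<close>

lemma sum_card_trees_le:
  assumes "m \<ge> 1"
  shows "(\<Sum>k<K. real (card (trees m k))) \<le> 2 * real (card (trees m K))"
proof (induction K)
  case (Suc K)
  define r where "r = 2 * real m * (2 * real K + 1) / (real K + 2)"
  have eq: "real (card (trees m (Suc K))) = real (card (trees m K)) * r"
    unfolding card_trees r_def by (simp add: cb_Suc divide_simps) (simp add: algebra_simps)
  show ?case
  proof (cases "K = 0")
    case True
    then show ?thesis using assms unfolding eq by (simp add: card_trees r_def mult_le_cancel_left1)
  next
    case False
    then have "3 * (real K + 2) \<le> 4 * 1 * (2 * real K + 1)" by simp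
    also have "\<dots> \<le> 4 * real m * (2 * real K + 1)"
      using assms by (intro mult_right_mono) auto
    finally have "3 \<le> 2 * r"
      by (simp add: r_def field_simps)
    then have "real (card (trees m K)) * 3 \<le> real (card (trees m K)) * (2 * r)"
      by (intro mult_left_mono) auto
    with Suc show ?thesis unfolding eq by simp
  qed
qed simp

text \<open>\<open>L\<close> is the logarithm of \<open>n\<close> to base \<open>4 * m\<close>. Its
  ceiling \<open>K\<close> satisfies \<open>n \<le> (4 * m) ^ K \<le> 4 * m * n\<close>, which
  balances the number of small trees against the loss from repeated large subtrees.\<close>

lemma avg_dag_estimate:
  fixes m n :: nat
  defines "L \<equiv> ln (real n) / ln (4 * real m)"
  assumes m: "m \<ge> 1" and n: "n \<ge> 2" and large: "ln (real n) ^ 3 \<le> real n"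
  shows "\<bar>avg_dag m n * sqrt (pi * L) / real n - 1\<bar> \<le> (8 * real m ^ 2 + 5) / L"
proof -
  let ?q = "4 * real m"
  define K where "K = nat \<lceil>L\<rceil>"
  define w where "w = sqrt (pi * L)"
  have "1 \<le> ln (4 :: real)"
    using e_less_272 by (subst ln_ge_iff) auto
  also have "\<dots> \<le> ln ?q" using m by simp
  finally have lnq: "1 \<le> ln ?q" .
  have L: "L > 0" using lnq n by (simp add: L_def)
  have K: "L \<le> real K" "real K < L + 1" "K \<ge> 1"
    using L by (auto simp: K_def) linarith+
  have qL: "?q powr L = real n" using lnq n m by (simp add: L_def powr_def)
  have "real n \<le> ?q powr real K"
    unfolding qL[symmetric] using K m by (intro powr_mono) auto
  then have qK: "real n \<le> ?q ^ K" using m by (simp add: powr_realpow)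
  have "?q powr real K \<le> ?q powr (L + 1)"
    using K m by (intro powr_mono) auto
  then have Kq: "?q ^ K \<le> ?q * real n" using m qL by (simp add: powr_realpow powr_add mult.commute)
  \<comment> \<open>Cancelling one factor \<open>4 * m\<close> leaves
    \<open>k < 2 ^ k \<le> (4 * m) ^ k \<le> n\<close> for \<open>K = Suc k\<close>.\<close>
  have Kn: "K \<le> n"
  proof -
    obtain k where k: "K = Suc k" using K(3) by (cases K) auto
    have "real k < 2 ^ k" by simp
    also have "\<dots> \<le> ?q ^ k" using m by (intro power_mono) auto
    also have "\<dots> \<le> real n" using Kq m by (simp add: k)
    finally show ?thesis by (simp add: k)
  qed
  have L_le: "L \<le> ln (real n)" using lnq n by (simp add: L_def field_simps)
  have "L ^ 3 \<le> real n" using power_mono[OF L_le, of 3] L large by simp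
  have "L \<le> real n" using L_le ln_le_minus_one[of "real n"] n by simp
  have w: "w > 0" using L by (simp add: w_def)
  have wK: "w * cb K \<le> 1"
  proof -
    have "w * cb K \<le> sqrt (pi * real K) * (1 / sqrt (pi * real K))"
      using K cb_le[of K] cb_pos[of K] L unfolding w_def
      by (intro mult_mono real_sqrt_le_mono) auto
    then show ?thesis using K by simp
  qed
  have wK2: "w * (cb K / (real K + 1)) \<le> 1 / L"
  proof -
    have "w * cb K / (real K + 1) \<le> 1 / L"
      using wK K L w cb_pos[of K] by (intro frac_le) auto
    then show ?thesis by simp
  qed

  \<comment> \<open>Upper bound: the small trees contribute \<open>8 * m ^ 2 / L\<close>, and the
    \<open>+ 1\<close> in \<open>n + 1\<close> costs \<open>1 / n \<le> 1 / L\<close>.\<close>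
  have "avg_dag m n \<le> 2 * (real m * ?q ^ K * cb K / (real K + 1)) + (real n + 1) * cb K"
    using avg_dag_le[OF m Kn] sum_card_trees_le[OF m, of K] unfolding card_trees by linarith
  also have "\<dots> \<le> 2 * (real m * (?q * real n) * cb K / (real K + 1)) + (real n + 1) * cb K"
    using Kq cb_pos[of K] by (intro add_right_mono mult_left_mono divide_right_mono mult_right_mono) auto
  finally have "avg_dag m n * w \<le>
      (2 * (real m * (?q * real n) * cb K / (real K + 1)) + (real n + 1) * cb K) * w"
    using w by (intro mult_right_mono) auto
  also have "\<dots> = 8 * real m ^ 2 * real n * (w * (cb K / (real K + 1))) + (real n + 1) * (w * cb K)"
    by (simp add: power2_eq_square algebra_simps)
  also have "\<dots> \<le> 8 * real m ^ 2 * real n * (1 / L) + (real n + 1) * 1"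
    using wK wK2 by (intro add_mono mult_left_mono) auto
  finally have "avg_dag m n * w / real n \<le> (8 * real m ^ 2 * real n * (1 / L) + (real n + 1) * 1) / real n"
    by (rule divide_right_mono) auto
  also have "\<dots> = 8 * real m ^ 2 / L + 1 + 1 / real n" using n by (simp add: field_simps)
  also have "1 / real n \<le> 1 / L" using \<open>L \<le> real n\<close> L by (intro divide_left_mono) auto
  finally have upper: "avg_dag m n * w / real n - 1 \<le> (8 * real m ^ 2 + 5) / L"
    using L by (simp add: add_divide_distrib) (smt (verit) divide_right_mono)

  \<comment> \<open>Lower bound: \<open>n \<le> (4 * m) ^ K\<close> absorbs the factor
    \<open>n\<close> in the loss from repeated subtrees.\<close>
  have "real n * cb K / (2 * (real K + 1) * ?q ^ K) \<le> (cb K / (real K + 1)) / 2"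
  proof -
    have "real n / ?q ^ K * (cb K / (real K + 1) / 2) \<le> 1 * (cb K / (real K + 1) / 2)"
      using qK m cb_pos[of K] by (intro mult_right_mono) auto
    then show ?thesis by (simp add: mult_ac)
  qed
  then have "avg_dag m n \<ge> (real n + 1) * (cb K - cb n - (cb K / (real K + 1)) / 2)"
    using avg_dag_ge[OF m Kn] by (smt (verit) mult_left_mono of_nat_0_le_iff)
  also have "(real n + 1) * (cb K - cb n - (cb K / (real K + 1)) / 2) =
      real n * cb K + cb K - (real n + 1) * (cb n + (cb K / (real K + 1)) / 2)"
    by (simp add: algebra_simps)
  also have "\<dots> \<ge> real n * cb K - (2 * real n) * (cb n + (cb K / (real K + 1)) / 2)"
    using n cb_pos[of n] cb_pos[of K]
    by (intro diff_mono mult_right_mono) auto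
  finally have "(real n * cb K - (2 * real n) * (cb n + (cb K / (real K + 1)) / 2)) * w \<le> avg_dag m n * w"
    using w by (intro mult_right_mono) auto
  then have "(real n * cb K - (2 * real n) * (cb n + (cb K / (real K + 1)) / 2)) * w / real n \<le> avg_dag m n * w / real n"
    by (rule divide_right_mono) auto
  also have "(real n * cb K - (2 * real n) * (cb n + (cb K / (real K + 1)) / 2)) * w / real n =
      w * cb K - 2 * (w * cb n) - w * (cb K / (real K + 1))"
    using n by (simp add: divide_simps) (simp add: algebra_simps)?
  finally have lower: "w * cb K - 2 * (w * cb n) - w * (cb K / (real K + 1)) \<le> avg_dag m n * w / real n" .
  \<comment> \<open>The tail term is at most \<open>sqrt (L / n)\<close>; here
    \<open>L ^ 3 \<le> n\<close> is used.\<close>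
  have "w * cb n \<le> 1 / L"
  proof -
    have "w * cb n \<le> sqrt (pi * L) * (1 / sqrt (pi * real n))"
      using cb_le[of n] n L unfolding w_def by (intro mult_left_mono) auto
    also have "\<dots> = sqrt (L / real n)" by (simp add: real_sqrt_mult real_sqrt_divide)
    also have "\<dots> \<le> sqrt ((1 / L) ^ 2)"
      using \<open>L ^ 3 \<le> real n\<close> L n
      by (intro real_sqrt_le_mono) (simp add: divide_simps power2_eq_square power3_eq_cube)
    finally show ?thesis using L by simp
  qed
  moreover have "w * cb K \<ge> 1 - 3 / 2 * (1 / L)"
  proof -
    \<comment> \<open>From \<open>K < L + 1\<close> follows \<open>K + 1/2 < L + 3/2\<close>, so
      \<open>w * cb K\<close> is at least \<open>sqrt x\<close>, and \<open>sqrt x \<ge> x\<close>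
      on the unit interval.\<close>
    define x where "x = L / (L + 3/2)"
    have x: "0 < x" "x \<le> 1" using L by (auto simp: x_def)
    have "1 - 3 / 2 * (1 / L) \<le> x" using L by (simp add: x_def divide_simps) (simp add: algebra_simps)
    also have "x = sqrt (x ^ 2)" using x by simp
    also have "\<dots> \<le> sqrt x"
      using x by (intro real_sqrt_le_mono) (simp add: power2_eq_square mult_le_cancel_left2)
    also have "\<dots> = w * (1 / sqrt (pi * (L + 3/2)))"
      by (simp add: x_def w_def real_sqrt_mult real_sqrt_divide)
    also have "\<dots> \<le> w * (1 / sqrt (pi * (real K + 1/2)))"
      using w K L by (intro mult_left_mono divide_left_mono real_sqrt_le_mono) auto
    also have "\<dots> \<le> w * cb K"
      using cb_ge[of K] w by (intro mult_left_mono) auto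
    finally show ?thesis .
  qed
  \<comment> \<open>The losses add up to \<open>3/2 + 2 + 1 = 9/2\<close>, below the 5 in the
    claim.\<close>
  ultimately have "avg_dag m n * w / real n - 1 \<ge> - (9 / 2) * (1 / L)"
    using lower wK2 by linarith
  also have "- (9 / 2) * (1 / L) \<ge> - ((8 * real m ^ 2 + 5) / L)"
    using L by (simp add: field_simps)
  finally show ?thesis using upper by (simp add: w_def abs_le_iff)
qed

theorem theorem9:
  fixes m :: nat
  assumes "m \<ge> 1"
  shows "(\<lambda>n::nat. avg_dag m n / (kappa m * real n / sqrt (ln (real n))) - 1)
           \<in> O(\<lambda>n. 1 / ln (real n))"
proof (rule bigoI)
  \<comment> \<open>The factor \<open>ln (4 * m)\<close> converts \<open>1 / L\<close> into
    \<open>1 / ln n\<close>.\<close>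
  let ?c = "(8 * real m ^ 2 + 5) * ln (4 * real m)"
  have "eventually (\<lambda>n. ln (real n) ^ 3 \<le> real n) at_top" by real_asymp
  then show "\<forall>\<^sub>F n in at_top. norm (avg_dag m n / (kappa m * real n / sqrt (ln (real n))) - 1)
      \<le> ?c * norm (1 / ln (real n))"
    using eventually_ge_at_top[of 2]
  proof eventually_elim
    case (elim n)
    have "ln (4 * real m) > 0" "ln (real n) > 0" using assms elim by auto
    then have "avg_dag m n / (kappa m * real n / sqrt (ln (real n))) =
        avg_dag m n * sqrt (pi * (ln (real n) / ln (4 * real m))) / real n"
      by (simp add: kappa_def real_sqrt_mult real_sqrt_divide divide_simps)
    then show ?case
      using avg_dag_estimate[OF assms elim(2,1)] \<open>ln (real n) > 0\<close> by simp
  qed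
qed

end
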